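(* Consider a map $c:\mathbb{R}^n\to\mathbb{R}^m$ that is $\mathcal{C}^2$ around the point $\bar x\in\mathbb{R}^n$, and a lower semicontinuous function $h:\mathbb{R}^m\to\overline{\mathbb{R}}$ that is finite at the vector $\bar c=c(\bar x)$. Assume that the transversality condition $$\partial^\infty h(\bar c)\cap\mathrm{Null}\big(\nabla c(\bar x)^*\big)=\{0\}$$ holds. Then there exist constants $\gamma>0$ and $\delta>0$ such that, for any point $x\in B_\delta(\bar x)$ and any step $d\in B_\delta(0)\subset\mathbb{R}^n$ for which $|h(c(x)+\nabla c(x)d)-h(\bar c)|<\delta$, there exists a point $x^+\in\mathbb{R}^n$ satisfying $$|x^+-(x+d)|\le\gamma|d|^2\quad\text{and}\quad h\big(c(x^+)\big)\le h\big(c(x)+\nabla c(x)d\big)+\gamma|d|^2.$$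
   Context: $\overline{\mathbb{R}}=[-\infty,+\infty]$; $|\cdot|$ is the Euclidean norm; $B_\epsilon(x)$ is the closed Euclidean ball of radius $\epsilon$ around $x$; $\nabla c(x):\mathbb{R}^n\to\mathbb{R}^m$ is the derivative of $c$ at $x$, $^*$ denotes the adjoint, $\mathrm{Null}$ the null space. The epigraph of $h$ is $\mathrm{epi}\,h=\{(c,r)\in\mathbb{R}^m\times\mathbb{R}:r\ge h(c)\}$. For a (locally) closed set $S$ and $s\in S$, the normal cone $N_S(s)$ is the set of all limits of sequences $\lambda_k(u_k-v_k)$ where $\lambda_k>0$, $u_k\to s$, $v_k\to s$, and $v_k$ is a closest point to $u_k$ in $S$. The horizon subdifferential is $\partial^\infty h(\bar c)=\{v\in\mathbb{R}^m:(v,0)\in N_{\mathrm{epi}\,h}(\bar c,h(\bar c))\}$. *)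

theory Defs
  imports "HOL-Analysis.Analysis"
begin

definition C2_around :: "('a::real_normed_vector \<Rightarrow> 'b::real_normed_vector) \<Rightarrow> 'a \<Rightarrow> bool" where
  "C2_around f a \<longleftrightarrow>
    (\<exists>U f' f''. open U \<and> a \<in> U \<and>
      (\<forall>x\<in>U. (f has_derivative blinfun_apply (f' x)) (at x)) \<and>
      (\<forall>x\<in>U. (f' has_derivative blinfun_apply (f'' x)) (at x)) \<and>
      continuous_on U (f'' :: 'a \<Rightarrow> 'a \<Rightarrow>\<^sub>L ('a \<Rightarrow>\<^sub>L 'b)))"

definition lower_semicontinuous :: "('a::topological_space \<Rightarrow> ereal) \<Rightarrow> bool" where
  "lower_semicontinuous h \<longleftrightarrow> (\<forall>a. h a \<le> Liminf (at a) h)"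

(* The library's epigraph is restricted to real-valued functions. The second
   component stays real, so points where h = \<infinity> contribute nothing. *)
definition epi :: "('a \<Rightarrow> ereal) \<Rightarrow> ('a \<times> real) set" where
  "epi h = {(a, r). h a \<le> ereal r}"

(* Limiting normal cone at s, meant for s in a locally closed set S. Closest
   points need not be unique, so closestness is a relation rather than the
   library's choice function closest_point. *)
definition normal_cone :: "'a::euclidean_space set \<Rightarrow> 'a \<Rightarrow> 'a set" where
  "normal_cone S s =
    {w. \<exists>(l::nat \<Rightarrow> real) u v.
          (\<forall>k. l k > 0) \<and> u \<longlonglongrightarrow> s \<and> v \<longlonglongrightarrow> s \<and>
          (\<forall>k. is_arg_min (dist (u k)) (\<lambda>y. y \<in> S) (v k)) \<and>
          (\<lambda>k. l k *\<^sub>R (u k - v k)) \<longlonglongrightarrow> w}"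

(* Meant for points a at which h is finite. The norm of the product type is
   sqrt (|a|^2 + r^2), hence closest points in the epigraph are Euclidean. *)
definition horizon_subdifferential ::
    "('a::euclidean_space \<Rightarrow> ereal) \<Rightarrow> 'a \<Rightarrow> 'a set" where
  "horizon_subdifferential h a =
    {v. (v, 0) \<in> normal_cone (epi h) (a, real_of_ereal (h a))}"

end

theory Submission
  imports Defs
begin

text \<open>
  Lifting \<open>c\<close> to \<open>G (x, r) = (c x, r)\<close>, the transversality condition says that the normal cone of
  the epigraph \<open>E\<close> meets the null space of the adjoint derivative of \<open>G\<close> only in 0, and this
  makes \<open>G\<close> metrically regular with respect to \<open>E\<close>: otherwise, minimizing
  \<open>dist (G q) E + \<epsilon> * dist q p\<close> near suitable points \<open>p\<close> yields minimizers \<open>q\<close> with \<open>G q \<notin> E\<close>, and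
  the unit vectors pointing from the projection of \<open>G q\<close> to \<open>G q\<close> accumulate, as \<open>\<epsilon> \<rightarrow> 0\<close>, at a
  forbidden normal. By Taylor's theorem the point \<open>(c (x + d), r)\<close> with
  \<open>r = h (c x + c' x d)\<close> lies within \<open>O(|d|\<^sup>2)\<close> of \<open>E\<close>, so metric regularity corrects \<open>(x + d, r)\<close>
  by \<open>O(|d|\<^sup>2)\<close> to a point \<open>(xplus, rplus)\<close> with \<open>h (c xplus) \<le> rplus\<close>.
\<close>

section \<open>Closedness of the epigraph\<close>

lemma closed_epi:
  fixes h :: "'a::metric_space \<Rightarrow> ereal"
  assumes "lower_semicontinuous h"
  shows "closed (epi h)"
proof -
  have "\<exists>T. open T \<and> p \<in> T \<and> T \<subseteq> - epi h" if p: "p \<in> - epi h" for p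
  proof -
    obtain a r where ar: "p = (a, r)" "ereal r < h a"
      using p by (cases p) (auto simp: epi_def not_le)
    \<comment> \<open>The level \<open>s\<close> separates both coordinates at once:
      \<open>h\<close> stays above \<open>s\<close> near \<open>a\<close>, while the second
      coordinates below \<open>s\<close> form a neighbourhood of \<open>r\<close>. The
      \<open>Liminf\<close> ignores \<open>a\<close> itself, where \<open>s < h a\<close> is used
      directly.\<close>
    obtain s where s: "ereal r < ereal s" "ereal s < h a"
      using ereal_dense2[OF ar(2)] by blast
    have "h a \<le> Liminf (at a) h"
      using assms by (simp add: lower_semicontinuous_def)
    with s(2) have "eventually (\<lambda>x. ereal s < h x) (at a)"
      by (simp add: le_Liminf_iff)
    then obtain A where A: "open A" "a \<in> A" "\<And>x. x \<in> A \<Longrightarrow> x \<noteq> a \<Longrightarrow> ereal s < h x"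
      unfolding eventually_at_topological by blast
    have "\<not> h x \<le> ereal t" if "x \<in> A" "t < s" for x t
    proof -
      have "ereal s < h x"
        using A(3) s(2) that(1) by blast
      moreover have "ereal t < ereal s"
        using that(2) by simp
      ultimately show ?thesis
        by (meson less_trans not_le)
    qed
    then have "A \<times> {..<s} \<subseteq> - epi h"
      by (auto simp: epi_def)
    moreover have "open (A \<times> {..<s})"
      using A(1) by (intro open_Times) auto
    ultimately show ?thesis
      using A(2) s(1) ar(1) by auto
  qed
  then have "open (- epi h)"
    using open_subopen by blast
  then show ?thesis
    by (simp add: closed_def)
qed

section \<open>Metric regularity from transversality\<close>

text \<open>Away from 0 the norm is differentiable with gradient \<open>sgn\<close>, and the penalty
  grows at rate at most \<open>\<epsilon>\<close>. The penalty may have a kink at \<open>q\<close>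
  (if \<open>q = p\<close>), so only one-sided difference quotients along rays are compared.\<close>

lemma local_min_dist_penalty_stationary:
  fixes G :: "'a::real_normed_vector \<Rightarrow> 'b::real_inner"
  assumes G: "(G has_derivative D) (at q)"
    and ne: "G q \<noteq> z" and "0 \<le> \<epsilon>"
    and min: "eventually (\<lambda>x. dist (G q) z + \<epsilon> * dist q p \<le> dist (G x) z + \<epsilon> * dist x p) (at q)"
  shows "- (\<epsilon> * norm e) \<le> sgn (G q - z) \<bullet> D e"
proof (cases "e = 0")
  case True
  then show ?thesis
    using \<open>0 \<le> \<epsilon>\<close> linear_0[OF has_derivative_linear[OF G]] by simp
next
  case False
  define g where "g t = norm (G (q + t *\<^sub>R e) - z)" for t :: real
  interpret D: bounded_linear D
    using G by (rule has_derivative_bounded_linear)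
  have line: "((\<lambda>t. q + t *\<^sub>R e) has_derivative (\<lambda>t. t *\<^sub>R e)) (at 0)"
    by (auto intro!: derivative_eq_intros)
  have "((\<lambda>t. G (q + t *\<^sub>R e)) has_derivative (\<lambda>t. D (t *\<^sub>R e))) (at 0)"
    using diff_chain_at[OF line, of G D] G by (simp add: o_def)
  then have "((\<lambda>t. G (q + t *\<^sub>R e) - z) has_derivative (\<lambda>t. D (t *\<^sub>R e))) (at 0)"
    by (auto intro!: derivative_eq_intros)
  from diff_chain_at[OF this, of norm] has_derivative_norm[of "G q - z"]
  have "(g has_derivative (\<lambda>t. D (t *\<^sub>R e) \<bullet> sgn (G q - z))) (at 0)"
    using ne by (simp add: o_def g_def[abs_def] inner_commute)
  then have "(g has_real_derivative (sgn (G q - z) \<bullet> D e)) (at 0)"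
    by (rule has_derivative_imp_has_field_derivative) (simp add: D.scaleR inner_commute)
  then have lim: "((\<lambda>t. (g t - g 0) / t) \<longlongrightarrow> sgn (G q - z) \<bullet> D e) (at_right 0)"
    using tendsto_mono[OF at_le[OF subset_UNIV]] by (fastforce simp: has_field_derivative_iff)
  \<comment> \<open>The filter \<open>at q\<close> is punctured, so the ray must leave
    \<open>q\<close>; this is where \<open>e\<close> has to be nonzero.\<close>
  have "filterlim (\<lambda>t. q + t *\<^sub>R e) (at q) (at_right 0)"
  proof (rule filterlim_atI)
    show "((\<lambda>t. q + t *\<^sub>R e) \<longlongrightarrow> q) (at_right 0)"
      by (auto intro!: tendsto_eq_intros)
    show "eventually (\<lambda>t. q + t *\<^sub>R e \<noteq> q) (at_right 0)"
      using False by (auto simp: eventually_at_filter)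
  qed
  from eventually_compose_filterlim[OF min this]
  have "eventually (\<lambda>t. - (\<epsilon> * norm e) \<le> (g t - g 0) / t) (at_right 0)"
    using eventually_at_right_less[of 0]
  proof eventually_elim
    case (elim t)
    have "dist (q + t *\<^sub>R e) p \<le> dist q p + t * norm e"
      using elim(2) norm_triangle_ineq[of "q - p" "t *\<^sub>R e"] by (simp add: dist_norm algebra_simps)
    then have "\<epsilon> * dist (q + t *\<^sub>R e) p \<le> \<epsilon> * (dist q p + t * norm e)"
      using \<open>0 \<le> \<epsilon>\<close> by (rule mult_left_mono)
    with elim(1) have "- (\<epsilon> * norm e) * t \<le> g t - g 0"
      by (simp add: g_def dist_norm algebra_simps)
    with elim(2) show ?case
      by (simp add: pos_le_divide_eq)
  qed
  then show ?thesis
    by (intro tendsto_lowerbound[OF lim]) auto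
qed

text \<open>This is Ekeland's variational principle, with compactness supplying an exact minimizer.
  Failure is applied with modulus \<open>1 / \<epsilon>\<close>: the minimizer \<open>q\<close> of
  the penalized distance lies so close to \<open>p\<close> that \<open>G q\<close> cannot be in
  \<open>S\<close>, hence \<open>G q\<close> differs from its projection \<open>z\<close>.\<close>

lemma metric_regularity_failure_almost_normal:
  fixes G :: "'a::euclidean_space \<Rightarrow> 'b::euclidean_space"
  assumes "open U" "a \<in> U"
    and G: "\<And>x. x \<in> U \<Longrightarrow> (G has_derivative D x) (at x)"
    and "closed S"
    and fail: "\<And>\<kappa> \<delta>. 0 < \<kappa> \<Longrightarrow> 0 < \<delta> \<Longrightarrow>
      \<exists>p\<in>cball a \<delta>. \<exists>y\<in>S \<inter> cball (G a) \<delta>. \<forall>q. G q \<in> S \<longrightarrow> \<kappa> * dist (G p) y < dist q p"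
    and "0 < \<epsilon>"
  shows "\<exists>q z. dist q a \<le> \<epsilon> \<and> is_arg_min (dist (G q)) (\<lambda>y. y \<in> S) z \<and> dist (G q) z \<le> \<epsilon> \<and>
    G q \<noteq> z \<and> (\<forall>e. - (\<epsilon> * norm e) \<le> sgn (G q - z) \<bullet> D q e)"
proof -
  obtain r where r: "0 < r" "cball a r \<subseteq> U"
    using \<open>open U\<close> \<open>a \<in> U\<close> open_contains_cball by blast
  define \<rho> where "\<rho> = min r \<epsilon>"
  have \<rho>: "0 < \<rho>" "\<rho> \<le> r" "\<rho> \<le> \<epsilon>"
    using r(1) \<open>0 < \<epsilon>\<close> by (auto simp: \<rho>_def)
  \<comment> \<open>\<open>\<tau>\<close> will bound \<open>\<eta> = dist (G p) y\<close>; the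
    factor 8 makes the search radius \<open>2 * (\<eta> / \<epsilon>)\<close> at most
    \<open>\<rho> / 4\<close>.\<close>
  define \<tau> where "\<tau> = min \<epsilon> (\<epsilon> * \<rho> / 8)"
  have \<tau>: "0 < \<tau>" "\<tau> \<le> \<epsilon>" "2 * (\<tau> / \<epsilon>) \<le> \<rho> / 4"
    using \<rho>(1) \<open>0 < \<epsilon>\<close> by (auto simp: \<tau>_def min_def field_simps)
  have "isCont G a"
    using G[OF \<open>a \<in> U\<close>] has_derivative_continuous by blast
  then obtain \<delta>0 where \<delta>0: "0 < \<delta>0" "\<And>x. dist x a < \<delta>0 \<Longrightarrow> dist (G x) (G a) < \<tau> / 2"
    using \<tau>(1) unfolding continuous_at_eps_delta by (metis half_gt_zero)
  \<comment> \<open>The first two bounds put \<open>G p\<close> and \<open>y\<close> within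
    \<open>\<tau> / 2\<close> of \<open>G a\<close>; the third keeps the search ball around
    \<open>p\<close> inside \<open>cball a \<rho>\<close>.\<close>
  define \<delta> where "\<delta> = min (\<delta>0 / 2) (min (\<tau> / 2) (\<rho> / 4))"
  have \<delta>: "0 < \<delta>" "\<delta> < \<delta>0" "\<delta> \<le> \<tau> / 2" "\<delta> \<le> \<rho> / 4"
    using \<delta>0(1) \<tau>(1) \<rho>(1) by (auto simp: \<delta>_def)
  obtain p y where p: "dist p a \<le> \<delta>" and y: "y \<in> S" "dist y (G a) \<le> \<delta>"
    and far: "\<And>q. G q \<in> S \<Longrightarrow> (1 / \<epsilon>) * dist (G p) y < dist q p"
  proof -
    have "0 < 1 / \<epsilon>"
      using \<open>0 < \<epsilon>\<close> by simp
    from fail[OF this \<delta>(1)] show ?thesis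
      using that by (auto simp only: mem_cball Int_iff dist_commute[of a] dist_commute[of "G a"])
  qed
  define \<eta> where "\<eta> = dist (G p) y"
  have "\<eta> \<le> \<tau>"
    using dist_triangle2[of "G p" y "G a"] \<delta>0(2)[of p] p y(2) \<delta> unfolding \<eta>_def by linarith
  have "\<eta> \<noteq> 0"
    using far[of p] y(1) by (auto simp: \<eta>_def)
  then have "0 < \<eta>"
    by (simp add: \<eta>_def)
  \<comment> \<open>Comparison with the value at \<open>p\<close> will give
    \<open>dist q p \<le> \<eta> / \<epsilon>\<close>. Doubling this radius makes \<open>q\<close>
    an interior point, hence a local minimizer.\<close>
  define R where "R = 2 * (\<eta> / \<epsilon>)"
  have "R \<le> 2 * (\<tau> / \<epsilon>)"
    using \<open>\<eta> \<le> \<tau>\<close> \<open>0 < \<epsilon>\<close> by (simp add: R_def divide_right_mono)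
  with \<tau>(3) have R: "0 < R" "R \<le> \<rho> / 4"
    using \<open>0 < \<eta>\<close> \<open>0 < \<epsilon>\<close> by (auto simp: R_def)
  have near: "dist x a \<le> \<rho>" if "x \<in> cball p R" for x
    using that dist_triangle[of x a p] p \<delta>(4) R(2) \<rho>(1) by (auto simp: dist_commute)
  then have inU: "x \<in> U" if "x \<in> cball p R" for x
    using that r(2) \<rho>(2) by (force simp: dist_commute)
  have "continuous_on (cball p R) G"
    by (rule has_derivative_continuous_on[OF has_derivative_at_withinI[OF G[OF inU]]])
  then have "continuous_on (cball p R) (\<lambda>x. infdist (G x) S + \<epsilon> * dist x p)"
    by (intro continuous_intros)
  then obtain q where q: "q \<in> cball p R"
    and qmin: "\<And>x. x \<in> cball p R \<Longrightarrow>
      infdist (G q) S + \<epsilon> * dist q p \<le> infdist (G x) S + \<epsilon> * dist x p"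
    using continuous_attains_inf[of "cball p R"] R(1) by fastforce
  obtain z where z: "z \<in> S" "infdist (G q) S = dist (G q) z"
    using infdist_attains_inf[OF \<open>closed S\<close>, of "G q"] y(1) by blast
  have zmin: "is_arg_min (dist (G q)) (\<lambda>y. y \<in> S) z"
    using z infdist_le[of _ S "G q"] by (auto simp: is_arg_min_def not_less)
  have val: "dist (G q) z + \<epsilon> * dist q p \<le> \<eta>"
    using qmin[of p] R(1) infdist_le[OF y(1), of "G p"] z(2) by (simp add: \<eta>_def)
  then have "\<epsilon> * dist q p \<le> \<eta>"
    using zero_le_dist[of "G q" z] by linarith
  then have qp: "dist q p \<le> \<eta> / \<epsilon>"
    using \<open>0 < \<epsilon>\<close> by (simp add: field_simps)
  then have "G q \<notin> S"
    using far[of q] by (auto simp: \<eta>_def)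
  with z(1) have "G q \<noteq> z"
    by auto
  have "q \<in> ball p R"
    using qp R(1) by (simp add: R_def dist_commute)
  then have "eventually (\<lambda>x. x \<in> ball p R) (at q)"
    by (intro eventually_at_in_open') auto
  \<comment> \<open>The distance to the fixed point \<open>z\<close> majorizes
    \<open>infdist\<close> to \<open>S\<close>, with equality at \<open>q\<close>, so minimality at
    \<open>q\<close> survives the replacement of \<open>infdist\<close> by a function smooth near
    \<open>G q\<close>.\<close>
  then have "eventually (\<lambda>x. dist (G q) z + \<epsilon> * dist q p \<le> dist (G x) z + \<epsilon> * dist x p) (at q)"
  proof eventually_elim
    case (elim x)
    then show ?case
      using qmin[of x] infdist_le[OF z(1), of "G x"] z(2) by simp
  qed
  from local_min_dist_penalty_stationary[OF G[OF inU[OF q]] \<open>G q \<noteq> z\<close> _ this] \<open>0 < \<epsilon>\<close>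
  have "- (\<epsilon> * norm e) \<le> sgn (G q - z) \<bullet> D q e" for e
    by simp
  moreover have "dist q a \<le> \<epsilon>"
    using near[OF q] \<rho>(3) by simp
  moreover have "dist (G q) z \<le> \<epsilon>"
  proof -
    have "0 \<le> \<epsilon> * dist q p"
      using \<open>0 < \<epsilon>\<close> by simp
    then show ?thesis
      using val \<open>\<eta> \<le> \<tau>\<close> \<tau>(2) by linarith
  qed
  ultimately show ?thesis
    using zmin \<open>G q \<noteq> z\<close> by blast
qed

lemma metric_regularity_of_transversality:
  fixes G :: "'a::euclidean_space \<Rightarrow> 'b::euclidean_space"
  assumes "open U" "a \<in> U"
    and G: "\<And>x. x \<in> U \<Longrightarrow> (G has_derivative D x) (at x)"
    and cont: "\<And>e. isCont (\<lambda>x. D x e) a"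
    and "closed S"
    and transversal: "\<And>w. w \<in> normal_cone S (G a) \<Longrightarrow> (\<And>e. w \<bullet> D a e = 0) \<Longrightarrow> w = 0"
  shows "\<exists>\<kappa>>0. \<exists>\<delta>>0. \<forall>p\<in>cball a \<delta>. \<forall>y\<in>S \<inter> cball (G a) \<delta>.
    \<exists>q. G q \<in> S \<and> dist q p \<le> \<kappa> * dist (G p) y"
proof (rule ccontr)
  assume contr: "\<not> ?thesis"
  have fail: "\<exists>p\<in>cball a \<delta>. \<exists>y\<in>S \<inter> cball (G a) \<delta>. \<forall>q. G q \<in> S \<longrightarrow> \<kappa> * dist (G p) y < dist q p"
    if "0 < \<kappa>" "0 < \<delta>" for \<kappa> \<delta>
    using contr that by (meson not_le)
  define \<epsilon> where "\<epsilon> k = inverse (real (Suc k))" for k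
  have \<epsilon>: "\<epsilon> \<longlonglongrightarrow> 0" "\<And>k. 0 < \<epsilon> k"
    unfolding \<epsilon>_def by (rule LIMSEQ_inverse_real_of_nat) simp
  have "\<forall>k. \<exists>q z. dist q a \<le> \<epsilon> k \<and> is_arg_min (dist (G q)) (\<lambda>y. y \<in> S) z \<and> dist (G q) z \<le> \<epsilon> k \<and>
    G q \<noteq> z \<and> (\<forall>e. - (\<epsilon> k * norm e) \<le> sgn (G q - z) \<bullet> D q e)"
    using metric_regularity_failure_almost_normal[OF assms(1,2) G \<open>closed S\<close> fail \<epsilon>(2)] by blast
  then obtain q z where
    q: "\<And>k. dist (q k) a \<le> \<epsilon> k" and
    z: "\<And>k. is_arg_min (dist (G (q k))) (\<lambda>y. y \<in> S) (z k)" "\<And>k. dist (G (q k)) (z k) \<le> \<epsilon> k"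
      "\<And>k. G (q k) \<noteq> z k" and
    stat: "\<And>k e. - (\<epsilon> k * norm e) \<le> sgn (G (q k) - z k) \<bullet> D (q k) e"
    by metis
  define w where "w k = sgn (G (q k) - z k)" for k
  have "w k \<in> sphere 0 1" for k
    using z(3)[of k] by (simp add: w_def norm_sgn)
  then obtain l s where l: "l \<in> sphere 0 1" "strict_mono s" "(w \<circ> s) \<longlonglongrightarrow> l"
    using compact_sphere[of "0 :: 'b" 1] unfolding compact_def by metis
  have "q \<longlonglongrightarrow> a"
    using \<epsilon>(1) q by (auto simp: tendsto_dist_iff[of q] intro: tendsto_sandwich[OF _ _ tendsto_const \<epsilon>(1)])
  then have qs: "(\<lambda>k. q (s k)) \<longlonglongrightarrow> a"
    using LIMSEQ_subseq_LIMSEQ[OF _ l(2)] by (fastforce simp: o_def)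
  have \<epsilon>s: "(\<lambda>k. \<epsilon> (s k)) \<longlonglongrightarrow> 0"
    using LIMSEQ_subseq_LIMSEQ[OF \<epsilon>(1) l(2)] by (simp add: o_def)
  have "isCont G a"
    using G[OF \<open>a \<in> U\<close>] has_derivative_continuous by blast
  then have Gqs: "(\<lambda>k. G (q (s k))) \<longlonglongrightarrow> G a"
    using qs by (rule isCont_tendsto_compose)
  have "(\<lambda>k. dist (G (q (s k))) (z (s k))) \<longlonglongrightarrow> 0"
    using z(2) by (auto intro: tendsto_sandwich[OF _ _ tendsto_const \<epsilon>s])
  then have zs: "(\<lambda>k. z (s k)) \<longlonglongrightarrow> G a"
    using Gqs tendsto_diff[OF Gqs, of "\<lambda>k. G (q (s k)) - z (s k)" 0]
    by (simp add: dist_norm tendsto_norm_zero_iff)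
  have "l \<in> normal_cone S (G a)"
    unfolding normal_cone_def mem_Collect_eq
  proof (intro exI conjI allI)
    \<comment> \<open>Reciprocal distances as multipliers turn the proximal normals into the unit
      vectors \<open>w (s k)\<close>, so the limit \<open>l\<close> has norm 1.\<close>
    show "0 < inverse (norm (G (q (s k)) - z (s k)))" for k
      using z(3) by simp
    show "(\<lambda>k. inverse (norm (G (q (s k)) - z (s k))) *\<^sub>R (G (q (s k)) - z (s k))) \<longlonglongrightarrow> l"
      using l(3) by (simp add: w_def sgn_div_norm o_def)
  qed (fact Gqs zs z(1))+
  moreover have "l \<bullet> D a e = 0" for e
  proof -
    \<comment> \<open>Stationarity is a one-sided inequality, but it holds for every direction;
      using it for both \<open>e\<close> and \<open>- e\<close> gives equality.\<close>
    have nonneg: "0 \<le> l \<bullet> D a e" for e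
    proof (rule LIMSEQ_le)
      show "(\<lambda>k. - (\<epsilon> (s k) * norm e)) \<longlonglongrightarrow> 0"
        using \<epsilon>s by (auto intro!: tendsto_eq_intros)
      show "(\<lambda>k. w (s k) \<bullet> D (q (s k)) e) \<longlonglongrightarrow> l \<bullet> D a e"
        using l(3) isCont_tendsto_compose[OF cont qs] by (intro tendsto_inner) (auto simp: o_def)
      show "\<exists>N. \<forall>k\<ge>N. - (\<epsilon> (s k) * norm e) \<le> w (s k) \<bullet> D (q (s k)) e"
        using stat by (auto simp: w_def)
    qed
    have "D a (- e) = - D a e"
      using G[OF \<open>a \<in> U\<close>] by (intro linear_neg has_derivative_linear)
    with nonneg[of e] nonneg[of "- e"] show ?thesis
      by simp
  qed
  ultimately have "l = 0"
    by (rule transversal)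
  with l(1) show False
    by simp
qed

section \<open>Second-order Taylor estimate\<close>

text \<open>Near \<open>a\<close> the second derivative is bounded by \<open>C\<close>, so
  \<open>f'\<close> is Lipschitz there. The estimate is uniform in both points because the base
  point of the linearization will vary.\<close>

lemma C2_around_quadratic_remainder:
  fixes f :: "'a::real_normed_vector \<Rightarrow> 'b::real_normed_vector"
  assumes "C2_around f a"
  shows "\<exists>U f' C. open U \<and> a \<in> U \<and> 0 < C \<and>
    (\<forall>x\<in>U. (f has_derivative blinfun_apply (f' x)) (at x)) \<and> isCont f' a \<and>
    (\<forall>x y. x \<in> U \<longrightarrow> y \<in> U \<longrightarrow> norm (f y - f x - f' x (y - x)) \<le> C * (norm (y - x))\<^sup>2)"
proof -
  obtain V f' and f'' :: "'a \<Rightarrow> 'a \<Rightarrow>\<^sub>L ('a \<Rightarrow>\<^sub>L 'b)" where V: "open V" "a \<in> V"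
    and f': "\<And>x. x \<in> V \<Longrightarrow> (f has_derivative blinfun_apply (f' x)) (at x)"
    and f'': "\<And>x. x \<in> V \<Longrightarrow> (f' has_derivative blinfun_apply (f'' x)) (at x)"
    and cont: "continuous_on V f''"
    using assms unfolding C2_around_def by blast
  have "isCont f'' a"
    using cont V continuous_on_eq_continuous_at by blast
  then obtain \<delta> where \<delta>: "0 < \<delta>" "\<And>x. dist x a < \<delta> \<Longrightarrow> dist (f'' x) (f'' a) < 1"
    unfolding continuous_at_eps_delta by (meson zero_less_one)
  obtain r where r: "0 < r" "ball a r \<subseteq> V"
    using V open_contains_ball by blast
  define U where "U = ball a (min r \<delta>)"
  define C where "C = norm (f'' a) + 1"
  have "0 < C"
    by (simp add: C_def add_nonneg_pos)
  have UV: "U \<subseteq> V"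
    using r(2) by (auto simp: U_def)
  have C: "norm (f'' x) \<le> C" if "x \<in> U" for x
    using \<delta>(2)[of x] that norm_triangle_sub[of "f'' x" "f'' a"]
    by (auto simp: U_def C_def dist_commute[of a] dist_norm[of "f'' x"])
  have lip: "norm (f' y - f' x) \<le> C * norm (y - x)" if "x \<in> U" "y \<in> U" for x y
    using that C UV
    by (intro differentiable_bound[of U f' "\<lambda>x. blinfun_apply (f'' x)"])
      (auto simp: U_def norm_blinfun.rep_eq[symmetric] intro!: has_derivative_at_withinI f'')
  have "norm (f y - f x - f' x (y - x)) \<le> C * (norm (y - x))\<^sup>2" if x: "x \<in> U" and y: "y \<in> U" for x y
  proof -
    have seg: "closed_segment x y \<subseteq> U"
      using x y by (intro closed_segment_subset) (auto simp: U_def)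
    \<comment> \<open>With the linear part at \<open>x\<close> subtracted, the derivative at
      \<open>t\<close> is \<open>f' t - f' x\<close>, of norm at most
      \<open>C * norm (t - x)\<close>; the mean value inequality supplies the second factor.\<close>
    have "norm ((f y - f' x y) - (f x - f' x x)) \<le> (C * norm (y - x)) * norm (y - x)"
    proof (rule differentiable_bound[of "closed_segment x y" "\<lambda>t. f t - f' x t" "\<lambda>t. blinfun_apply (f' t - f' x)"])
      fix t assume t: "t \<in> closed_segment x y"
      show "((\<lambda>t. f t - f' x t) has_derivative blinfun_apply (f' t - f' x)) (at t within closed_segment x y)"
      proof (rule has_derivative_eq_rhs)
        have "t \<in> V"
          using t seg UV by blast
        then show "((\<lambda>t. f t - f' x t) has_derivative (\<lambda>e. f' t e - f' x e)) (at t within closed_segment x y)"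
          by (intro has_derivative_diff bounded_linear_imp_has_derivative blinfun.bounded_linear_right
              has_derivative_at_withinI[OF f'])
      qed (simp add: fun_eq_iff blinfun.diff_left)
      have "norm (f' t - f' x) \<le> C * norm (t - x)"
        using lip x seg t by blast
      also have "\<dots> \<le> C * norm (y - x)"
        using segment_bound(1)[OF t] \<open>0 < C\<close> by simp
      finally show "onorm (blinfun_apply (f' t - f' x)) \<le> C * norm (y - x)"
        by (simp add: norm_blinfun.rep_eq)
    qed auto
    then show ?thesis
      by (simp add: blinfun.diff_right algebra_simps power2_eq_square)
  qed
  moreover have "isCont f' a"
    using f''[OF V(2)] has_derivative_continuous by blast
  moreover have "open U" "a \<in> U"
    using r(1) \<delta>(1) by (auto simp: U_def)
  ultimately show ?thesis
    using \<open>0 < C\<close> f' UV by blast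
qed

section \<open>Correcting a linearized step\<close>

theorem theorem4p6:
  fixes c :: "real ^ 'n \<Rightarrow> real ^ 'm"
    and h :: "real ^ 'm \<Rightarrow> ereal"
    and xbar :: "real ^ 'n"
    and cbar :: "real ^ 'm"
  assumes "C2_around c xbar"
    and "lower_semicontinuous h"
    and "cbar = c xbar"
    and "\<bar>h cbar\<bar> \<noteq> \<infinity>"
    and "horizon_subdifferential h cbar
           \<inter> {v. adjoint (frechet_derivative c (at xbar)) v = 0} = {0}"
  shows "\<exists>\<gamma>>0. \<exists>\<delta>>0. \<forall>x\<in>cball xbar \<delta>. \<forall>d\<in>cball 0 \<delta>.
           \<bar>h (c x + frechet_derivative c (at x) d) - h cbar\<bar> < ereal \<delta> \<longrightarrow>
           (\<exists>xplus. norm (xplus - (x + d)) \<le> \<gamma> * (norm d)\<^sup>2 \<and>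
              h (c xplus) \<le> h (c x + frechet_derivative c (at x) d) + ereal (\<gamma> * (norm d)\<^sup>2))"
proof -
  obtain U c' C where U: "open U" "xbar \<in> U" and "0 < C"
    and c': "\<And>x. x \<in> U \<Longrightarrow> (c has_derivative blinfun_apply (c' x)) (at x)"
    and c'_cont: "isCont c' xbar"
    and taylor: "\<And>x y. x \<in> U \<Longrightarrow> y \<in> U \<Longrightarrow>
      norm (c y - c x - c' x (y - x)) \<le> C * (norm (y - x))\<^sup>2"
    using C2_around_quadratic_remainder[OF assms(1)] by metis
  have frechet: "frechet_derivative c (at x) = blinfun_apply (c' x)" if "x \<in> U" for x
    using frechet_derivative_at[OF c'[OF that]] by simp
  obtain rbar where rbar: "h cbar = ereal rbar"
    using assms(4) by auto
  define G where "G p = (c (fst p), snd p)" for p :: "(real ^ 'n) \<times> real"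
  define D where "D p e = (c' (fst p) (fst e), snd e)" for p e :: "(real ^ 'n) \<times> real"
  have G': "(G has_derivative D p) (at p)" if "p \<in> U \<times> UNIV" for p
  proof -
    have "((\<lambda>p. c (fst p)) has_derivative (\<lambda>e. c' (fst p) (fst e))) (at p)"
      using that by (intro has_derivative_compose[of fst fst p UNIV c, simplified] c')
        (auto intro!: derivative_eq_intros)
    then show ?thesis
      unfolding G_def D_def by (auto intro!: derivative_eq_intros)
  qed
  have D_cont: "isCont (\<lambda>p. D p e) (xbar, rbar)" for e
  proof -
    have "isCont (\<lambda>p. c' (fst p)) (xbar, rbar)"
      using c'_cont by (intro isCont_o2[OF isCont_fst[OF continuous_ident]]) simp
    then show ?thesis
      unfolding D_def by (intro continuous_intros)
  qed
  \<comment> \<open>Testing with \<open>(0, 1)\<close> kills the last component of \<open>w\<close>,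
    so \<open>fst w\<close> is a horizon subgradient; testing with \<open>(e, 0)\<close> puts it in
    the null space of the adjoint.\<close>
  have transversal: "w = 0"
    if "w \<in> normal_cone (epi h) (G (xbar, rbar))" and orth: "\<And>e. w \<bullet> D (xbar, rbar) e = 0" for w
  proof -
    have "snd w = 0"
      using orth[of "(0, 1)"] by (cases w) (simp add: D_def)
    moreover from this that(1) have "fst w \<in> horizon_subdifferential h cbar"
      by (cases w) (simp add: horizon_subdifferential_def G_def rbar flip: assms(3))
    moreover have "adjoint (c' xbar) (fst w) = 0"
    proof -
      have "fst w \<bullet> c' xbar e = 0" for e
        using orth[of "(e, 0)"] by (cases w) (simp add: D_def)
      then have "e \<bullet> adjoint (c' xbar) (fst w) = 0" for e
        by (simp add: adjoint_works bounded_linear.linear[OF blinfun.bounded_linear_right] inner_commute)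
      then show ?thesis
        using inner_eq_zero_iff by blast
    qed
    ultimately show ?thesis
      using assms(5) frechet[OF U(2)] by (intro prod_eqI) auto
  qed
  obtain \<kappa> \<delta>1 where "0 < \<kappa>" "0 < \<delta>1"
    and regular: "\<And>p y. p \<in> cball (xbar, rbar) \<delta>1 \<Longrightarrow> y \<in> epi h \<Longrightarrow> y \<in> cball (cbar, rbar) \<delta>1 \<Longrightarrow>
      \<exists>q. G q \<in> epi h \<and> dist q p \<le> \<kappa> * dist (G p) y"
  proof -
    have "open (U \<times> (UNIV :: real set))" "(xbar, rbar) \<in> U \<times> UNIV"
      using U by (simp_all add: open_Times)
    note regular = metric_regularity_of_transversality[OF this G' D_cont closed_epi[OF assms(2)] transversal]
    have "G (xbar, rbar) = (cbar, rbar)"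
      by (simp add: G_def assms(3))
    with regular show ?thesis
      using that by (metis IntI)
  qed
  \<comment> \<open>Joint continuity in base point and step keeps the linearized value near
    \<open>cbar\<close>, within range of the regularity estimate.\<close>
  have "isCont (\<lambda>p. c (fst p) + c' (fst p) (snd p)) (xbar, 0)"
  proof -
    have "isCont c xbar"
      using c'[OF U(2)] has_derivative_continuous by blast
    then have "isCont (\<lambda>p. c (fst p)) (xbar, 0 :: real ^ 'n)"
      by (intro isCont_o2[OF isCont_fst[OF continuous_ident]]) simp
    moreover have "isCont (\<lambda>p. c' (fst p)) (xbar, 0 :: real ^ 'n)"
      using c'_cont by (intro isCont_o2[OF isCont_fst[OF continuous_ident]]) simp
    ultimately show ?thesis
      by (intro continuous_intros)
  qed
  then obtain \<delta>2 where \<delta>2: "0 < \<delta>2"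
    "\<And>p. dist p (xbar, 0) < \<delta>2 \<Longrightarrow> dist (c (fst p) + c' (fst p) (snd p)) cbar < \<delta>1 / 2"
    using \<open>0 < \<delta>1\<close> unfolding continuous_at_eps_delta
    by (metis assms(3) fst_conv snd_conv blinfun.zero_right add_0_right half_gt_zero)
  obtain r where r: "0 < r" "cball xbar r \<subseteq> U"
    using U open_contains_cball by blast
  define \<gamma> where "\<gamma> = \<kappa> * C"
  \<comment> \<open>Since \<open>x + d\<close> is within \<open>2 * \<delta>\<close> of
    \<open>xbar\<close> and the height within \<open>\<delta>\<close> of \<open>rbar\<close>, the
    lifted point is within \<open>3 * \<delta>\<close>, hence within \<open>\<delta>1\<close>, of
    \<open>(xbar, rbar)\<close>; \<open>r / 2\<close> keeps \<open>x + d\<close> in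
    \<open>U\<close>.\<close>
  define \<delta> where "\<delta> = min (\<delta>1 / 4) (min (\<delta>2 / 4) (r / 2))"
  have "0 < \<gamma>"
    using \<open>0 < \<kappa>\<close> \<open>0 < C\<close> by (simp add: \<gamma>_def)
  have \<delta>: "0 < \<delta>" "\<delta> \<le> \<delta>1 / 4" "\<delta> \<le> \<delta>2 / 4" "\<delta> \<le> r / 2"
    using \<open>0 < \<delta>1\<close> \<delta>2(1) r(1) by (auto simp: \<delta>_def)
  have "\<exists>xplus. norm (xplus - (x + d)) \<le> \<gamma> * (norm d)\<^sup>2 \<and>
      h (c xplus) \<le> h (c x + frechet_derivative c (at x) d) + ereal (\<gamma> * (norm d)\<^sup>2)"
    if x: "x \<in> cball xbar \<delta>" and d: "d \<in> cball 0 \<delta>"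
      and close: "\<bar>h (c x + frechet_derivative c (at x) d) - h cbar\<bar> < ereal \<delta>" for x d
  proof -
    have dist_pair: "dist (u, v) (u', v') \<le> dist u u' + dist v v'"
      for u u' :: "'x::metric_space" and v v' :: "'y::metric_space"
      by (simp add: dist_Pair_Pair sqrt_sum_squares_le_sum)
    have xd: "dist x xbar \<le> \<delta>" "norm d \<le> \<delta>" "dist (x + d) xbar \<le> 2 * \<delta>"
      using x d norm_triangle_ineq[of "x - xbar" d]
      by (auto simp: dist_norm norm_minus_commute algebra_simps)
    have "x \<in> U" "x + d \<in> U"
      using xd \<delta>(1,4) r(2) by (auto simp: subset_iff dist_commute)
    define y where "y = c x + c' x d"
    have y: "frechet_derivative c (at x) d = c' x d"
      using frechet[OF \<open>x \<in> U\<close>] by simp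
    \<comment> \<open>Closeness to the finite value \<open>rbar\<close> excludes infinite
      \<open>h y\<close>, so \<open>(y, s)\<close> is a point of the epigraph.\<close>
    obtain s where s: "h y = ereal s" "\<bar>s - rbar\<bar> < \<delta>"
      using close unfolding y y_def[symmetric] rbar by (cases "h y") auto
    have "dist (x, d) (xbar, 0) < \<delta>2"
      using dist_pair[of x d xbar 0] xd(1,2) \<delta>(1,3) by simp
    then have "dist y cbar < \<delta>1 / 2"
      using \<delta>2(2)[of "(x, d)"] by (simp add: y_def)
    then have "(y, s) \<in> cball (cbar, rbar) \<delta>1"
      using dist_pair[of cbar rbar y s] s(2) \<delta>(2) by (simp add: dist_real_def dist_commute)
    moreover have "(x + d, s) \<in> cball (xbar, rbar) \<delta>1"
      using dist_pair[of xbar rbar "x + d" s] xd(3) s(2) \<delta>(1,2)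
      by (simp add: dist_real_def dist_commute)
    moreover have "(y, s) \<in> epi h"
      using s(1) by (simp add: epi_def)
    ultimately obtain q where q: "G q \<in> epi h" "dist q (x + d, s) \<le> \<kappa> * dist (G (x + d, s)) (y, s)"
      using regular by blast
    \<comment> \<open>The two points share the height \<open>s\<close>, so their distance is exactly
      the Taylor remainder of \<open>c\<close> at \<open>x\<close> for the step
      \<open>d\<close>.\<close>
    have "dist (G (x + d, s)) (y, s) \<le> C * (norm d)\<^sup>2"
      using taylor[OF \<open>x \<in> U\<close> \<open>x + d \<in> U\<close>]
      by (simp add: G_def y_def dist_Pair_Pair dist_norm diff_diff_add)
    then have "\<kappa> * dist (G (x + d, s)) (y, s) \<le> \<gamma> * (norm d)\<^sup>2"
      using \<open>0 < \<kappa>\<close> by (simp add: \<gamma>_def)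
    with q(2) have q_le: "dist q (x + d, s) \<le> \<gamma> * (norm d)\<^sup>2"
      by linarith
    have "norm (fst q - (x + d)) \<le> \<gamma> * (norm d)\<^sup>2"
      using dist_fst_le[of q "(x + d, s)"] q_le by (simp add: dist_norm)
    moreover have "h (c (fst q)) \<le> ereal (snd q)"
      using q(1) by (simp add: G_def epi_def)
    moreover have "snd q \<le> s + \<gamma> * (norm d)\<^sup>2"
      using dist_snd_le[of q "(x + d, s)"] q_le by (simp add: dist_real_def)
    ultimately show ?thesis
      unfolding y y_def[symmetric] s(1) by (intro exI[of _ "fst q"]) (auto intro: order_trans)
  qed
  with \<open>0 < \<gamma>\<close> \<delta>(1) show ?thesis
    by blast
qed

end
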